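(* For $S\subseteq V^{\setminus i}$ with $\alpha=\alpha_{\mathrm{ess}}/q(S)$, define for $j\in\mathcal{D}_u^{V^{\setminus i}}$ $\overline{h}_{\vec{n}_j}(\alpha)=h_{\vec{n}_j}(\alpha)$ if $\alpha\le 1$ and $\frac{\partial h_{\vec{n}_j}}{\partial\alpha}(\alpha)\ge 0$, and $\overline{h}_{\vec{n}_j}(\alpha)=0$ otherwise. For $j_S\in\mathcal{D}_u^{S}$ let $$\underline{h}(S,j_S)=\sum_{\substack{j\in\mathcal{D}_u^{V^{\setminus i}}:\\ j^{S}=j_S}}\mathrm{ML}(\vec{n}_j)+\min_{\substack{j\in\mathcal{D}_u^{V^{\setminus i}}:\\ j^{S}=j_S}}\Big(-\mathrm{ML}(\vec{n}_j)+\min\big\{\mathrm{ML}(\vec{n}_j);\ f(V^{\setminus i},j)+g(V^{\setminus i},j,\alpha);\ \overline{h}_{\vec{n}_j}(\alpha)\big\}\Big),$$ and let $\mathrm{ub}_h(S)=\sum_{j_S\in\mathcal{D}_u^{S}}\underline{h}(S,j_S)$. Then $\mathrm{ub}_h(S)\ge\mathrm{LBDeu}(T)$ for every $T$ with $S\subset T\subseteq V^{\setminus i}$.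
   Context: Let $V=\{1,\dots,n\}$ index discrete random variables, fix a child variable $i\in V$ and put $V^{\setminus i}=V\setminus\{i\}$. Each variable $v$ has a finite nonempty state space $c(v)$; for $S\subseteq V$, $c(S)=\prod_{v\in S}c(v)$ (a singleton if $S=\emptyset$) and $q(S)=|c(S)|$; $q(i)=|c(i)|$. For $j\in c(S')$ and $S\subseteq S'$, $j^{S}\in c(S)$ is the projection of $j$. The data $\mathcal{D}$ is a finite multiset of elements of $c(V)$; $\mathcal{D}^{S}$ is the multiset of projections onto $S$, and $\mathcal{D}_u^{S}$ is the set of distinct elements of $\mathcal{D}^{S}$. For $S\subseteq V^{\setminus i}$ and $j\in c(S)$, $\mathcal{D}_u^{S\cup\{i\}}(j)$ is the set of elements of $\mathcal{D}_u^{S\cup\{i\}}$ whose projection onto $S$ is $j$; $n_j$ is the number of occurrences of $j$ in $\mathcal{D}^{S}$, and for $k\in c(i)$, $n_{j,k}$ is the number of elements of $\mathcal{D}^{S\cup\{i\}}$ (with multiplicity) with $S$-part $j$ and $i$-part $k$, so $n_j=\sum_k n_{j,k}$; $\vec{n}_j=(n_{j,k})_{k\in c(i)}$. Fix $\alpha_{\mathrm{ess}}>0$. For $j\in c(S)$, $\alpha_j=\alpha_{\mathrm{ess}}/q(S)$ and $\alpha_{j,k}=\alpha_{\mathrm{ess}}/(q(S)q(i))$. With $\Gamma_\alpha(x)=\Gamma(x+\alpha)/\Gamma(\alpha)$, $$\mathrm{LLBDeu}(S,j)=-\log\Gamma_{\alpha_j}(n_j)+\sum_{k\in c(i)}\log\Gamma_{\alpha_{j,k}}(n_{j,k}),\qquad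 \mathrm{LBDeu}(S)=\sum_{j\in\mathcal{D}_u^{S}}\mathrm{LLBDeu}(S,j).$$ For $S\subseteq V^{\setminus i}$ and $j\in\mathcal{D}_u^{S}$: $f(S,j)=-|\mathcal{D}_u^{S\cup\{i\}}(j)|\log q(i)$. For $\alpha>0$, $g(S,j,\alpha)=-\sum_{l=1}^{k'-1}\log(1+n_{j,l}/\alpha)$, where the counts $(n_{j,k})_{k\in c(i)}$ are listed in non-increasing order as $n_{j,1}\ge\dots\ge n_{j,q(i)}$ and $k'$ is the largest index with $n_{j,k'}>0$. Further, $\mathrm{ML}(\vec{n}_j)=\sum_{k\in c(i)}n_{j,k}\log(n_{j,k}/n_j)$ with $0\log 0=0$, and for $\alpha>0$, $h_{\vec{n}_j}(\alpha)=-\log\Gamma_{\alpha}(n_j)+\sum_{k\in c(i)}\log\Gamma_{\alpha/q(i)}(n_{j,k})$, a function of $\alpha$ for fixed $\vec{n}_j$. The symbol $\subset$ denotes proper inclusion. *)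

theory Defs
  imports "HOL-Analysis.Analysis"
begin

(* An element of c(S) is an extensional function j in PiE S c (all state spaces are subsets of one
   type); the projection of j onto S is "restrict j S". *)

definition qsize :: "('v \<Rightarrow> 'a set) \<Rightarrow> 'v set \<Rightarrow> nat"
  where "qsize c S = card (Pi\<^sub>E S c)"

definition data_on :: "('v \<Rightarrow> 'a) multiset \<Rightarrow> 'v set \<Rightarrow> ('v \<Rightarrow> 'a) multiset"
  where "data_on D S = image_mset (\<lambda>x. restrict x S) D"

definition uniq_on :: "('v \<Rightarrow> 'a) multiset \<Rightarrow> 'v set \<Rightarrow> ('v \<Rightarrow> 'a) set"
  where "uniq_on D S = set_mset (data_on D S)"

definition uniq_ext :: "('v \<Rightarrow> 'a) multiset \<Rightarrow> 'v \<Rightarrow> 'v set \<Rightarrow> ('v \<Rightarrow> 'a) \<Rightarrow> ('v \<Rightarrow> 'a) set"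
  where "uniq_ext D i S j = {x \<in> uniq_on D (S \<union> {i}). restrict x S = j}"

definition cnt :: "('v \<Rightarrow> 'a) multiset \<Rightarrow> 'v set \<Rightarrow> ('v \<Rightarrow> 'a) \<Rightarrow> nat"
  where "cnt D S j = count (data_on D S) j"

(* n_{j,k}; the vector of counts of j is the function "cnt_child D i S j" on c(i). *)
definition cnt_child :: "('v \<Rightarrow> 'a) multiset \<Rightarrow> 'v \<Rightarrow> 'v set \<Rightarrow> ('v \<Rightarrow> 'a) \<Rightarrow> 'a \<Rightarrow> nat"
  where "cnt_child D i S j k
    = size {# x \<in># data_on D (S \<union> {i}). restrict x S = j \<and> x i = k #}"

definition Gamma_ratio :: "real \<Rightarrow> real \<Rightarrow> real"
  where "Gamma_ratio a x = Gamma (x + a) / Gamma a"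

definition LLBDeu ::
  "('v \<Rightarrow> 'a set) \<Rightarrow> 'v \<Rightarrow> ('v \<Rightarrow> 'a) multiset \<Rightarrow> real \<Rightarrow> 'v set \<Rightarrow> ('v \<Rightarrow> 'a) \<Rightarrow> real"
  where "LLBDeu c i D \<alpha>ess S j
    = - ln (Gamma_ratio (\<alpha>ess / qsize c S) (cnt D S j))
      + (\<Sum>k\<in>c i. ln (Gamma_ratio (\<alpha>ess / (qsize c S * card (c i))) (cnt_child D i S j k)))"

definition LBDeu ::
  "('v \<Rightarrow> 'a set) \<Rightarrow> 'v \<Rightarrow> ('v \<Rightarrow> 'a) multiset \<Rightarrow> real \<Rightarrow> 'v set \<Rightarrow> real"
  where "LBDeu c i D \<alpha>ess S = (\<Sum>j\<in>uniq_on D S. LLBDeu c i D \<alpha>ess S j)"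

definition f_bound ::
  "('v \<Rightarrow> 'a set) \<Rightarrow> 'v \<Rightarrow> ('v \<Rightarrow> 'a) multiset \<Rightarrow> 'v set \<Rightarrow> ('v \<Rightarrow> 'a) \<Rightarrow> real"
  where "f_bound c i D S j = - real (card (uniq_ext D i S j)) * ln (card (c i))"

(* The counts n_{j,1} >= ... >= n_{j,q(i)}, with list index l - 1 for the index l. *)
definition sorted_cnts ::
  "('v \<Rightarrow> 'a set) \<Rightarrow> 'v \<Rightarrow> ('v \<Rightarrow> 'a) multiset \<Rightarrow> 'v set \<Rightarrow> ('v \<Rightarrow> 'a) \<Rightarrow> nat list"
  where "sorted_cnts c i D S j
    = rev (sorted_list_of_multiset (image_mset (cnt_child D i S j) (mset_set (c i))))"

definition last_pos ::
  "('v \<Rightarrow> 'a set) \<Rightarrow> 'v \<Rightarrow> ('v \<Rightarrow> 'a) multiset \<Rightarrow> 'v set \<Rightarrow> ('v \<Rightarrow> 'a) \<Rightarrow> nat"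
  where "last_pos c i D S j = Max {l \<in> {1..card (c i)}. sorted_cnts c i D S j ! (l - 1) > 0}"

definition g_bound ::
  "('v \<Rightarrow> 'a set) \<Rightarrow> 'v \<Rightarrow> ('v \<Rightarrow> 'a) multiset \<Rightarrow> 'v set \<Rightarrow> ('v \<Rightarrow> 'a) \<Rightarrow> real \<Rightarrow> real"
  where "g_bound c i D S j \<alpha>
    = - (\<Sum>l = 1..last_pos c i D S j - 1. ln (1 + sorted_cnts c i D S j ! (l - 1) / \<alpha>))"

(* The next three functions take the state space K = c(i) and the vector m of counts on K; the
   total count is the sum of m over K. The convention 0 log 0 = 0 holds automatically. *)

definition max_loglik :: "'a set \<Rightarrow> ('a \<Rightarrow> nat) \<Rightarrow> real"
  where "max_loglik K m = (\<Sum>k\<in>K. real (m k) * ln (real (m k) / real (\<Sum>k'\<in>K. m k')))"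

definition h_fun :: "'a set \<Rightarrow> ('a \<Rightarrow> nat) \<Rightarrow> real \<Rightarrow> real"
  where "h_fun K m \<alpha> = - ln (Gamma_ratio \<alpha> (\<Sum>k\<in>K. m k))
      + (\<Sum>k\<in>K. ln (Gamma_ratio (\<alpha> / card K) (m k)))"

definition h_bar :: "'a set \<Rightarrow> ('a \<Rightarrow> nat) \<Rightarrow> real \<Rightarrow> real"
  where "h_bar K m \<alpha> = (if \<alpha> \<le> 1 \<and> deriv (h_fun K m) \<alpha> \<ge> 0 then h_fun K m \<alpha> else 0)"

definition full_ext ::
  "'v set \<Rightarrow> 'v \<Rightarrow> ('v \<Rightarrow> 'a) multiset \<Rightarrow> 'v set \<Rightarrow> ('v \<Rightarrow> 'a) \<Rightarrow> ('v \<Rightarrow> 'a) set"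
  where "full_ext V i D S jS = {j \<in> uniq_on D (V - {i}). restrict j S = jS}"

definition h_under ::
  "'v set \<Rightarrow> ('v \<Rightarrow> 'a set) \<Rightarrow> 'v \<Rightarrow> ('v \<Rightarrow> 'a) multiset \<Rightarrow> real \<Rightarrow> 'v set \<Rightarrow> ('v \<Rightarrow> 'a) \<Rightarrow> real"
  where "h_under V c i D \<alpha>ess S jS =
    (let W = V - {i};
         \<alpha> = \<alpha>ess / qsize c S;
         L = (\<lambda>j. max_loglik (c i) (cnt_child D i W j))
     in (\<Sum>j\<in>full_ext V i D S jS. L j)
        + Min ((\<lambda>j. - L j
                     + Min {L j,
                            f_bound c i D W j + g_bound c i D W j \<alpha>,
                            h_bar (c i) (cnt_child D i W j) \<alpha>})
               ` full_ext V i D S jS))"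

definition ub_h ::
  "'v set \<Rightarrow> ('v \<Rightarrow> 'a set) \<Rightarrow> 'v \<Rightarrow> ('v \<Rightarrow> 'a) multiset \<Rightarrow> real \<Rightarrow> 'v set \<Rightarrow> real"
  where "ub_h V c i D \<alpha>ess S = (\<Sum>jS\<in>uniq_on D S. h_under V c i D \<alpha>ess S jS)"

end

theory Submission
  imports Defs
begin

text \<open>Up to the order of the data, \<open>exp (h_fun K m \<alpha>)\<close> is the probability of the counts \<open>m\<close> under a
  Polya urn. Among the data below a configuration of \<open>T\<close>, single out those of one configuration \<open>j\<close>
  of \<open>V - {i}\<close>. By the chain rule the score is \<open>h_fun\<close> of \<open>j\<close> plus the log-probability of the rest
  under an urn with updated parameters. The latter is at most a maximum log-likelihood, as a
  Dirichlet mean of a likelihood does not exceed its maximum, and maximum log-likelihoods only grow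
  when the data are split further. Below each configuration of \<open>S\<close>, take the minimising \<open>j\<close>.

  It remains to bound \<open>h_fun\<close> of \<open>j\<close> at parameters up to \<open>\<alpha> = \<alpha>ess / qsize c S\<close> by the terms of the
  minimum. The bound by \<open>f_bound + g_bound\<close> comes from drawing the states one after another. The
  bound by \<open>h_bar\<close> holds because \<open>x\<close> times the derivative of \<open>h_fun\<close> at \<open>x\<close> decreases on \<open>(0, 1]\<close>,
  so that a nonnegative derivative at \<open>\<alpha> \<le> 1\<close> is nonnegative on all of \<open>(0, \<alpha>]\<close>.\<close>

subsection \<open>Maximum likelihood and the Polya urn\<close>

text \<open>A binomial likelihood peaks at the observed frequency. With \<open>x\<close> and
  \<open>y\<close> the ratios of \<open>t\<close> and \<open>1 - t\<close> to the observed
  frequencies, \<open>x \<le> exp (x - 1)\<close> and \<open>y \<le> exp (y - 1)\<close> bound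
  \<open>x ^ m * y ^ l\<close> by an exponential whose exponents cancel.\<close>

lemma power_mult_power_le:
  fixes t :: real
  assumes t: "0 \<le> t" "t \<le> 1"
  shows "t ^ m * (1 - t) ^ l * real (m + l) ^ (m + l) \<le> real m ^ m * real l ^ l"
proof -
  consider "m = 0" | "l = 0" | "m > 0" "l > 0" by auto
  then show ?thesis
  proof cases
    case 1
    then show ?thesis
      using t mult_right_mono[of "(1 - t) ^ l" 1 "real l ^ l"] by (simp add: power_le_one)
  next
    case 2
    then show ?thesis
      using t mult_right_mono[of "t ^ m" 1 "real m ^ m"] by (simp add: power_le_one)
  next
    case 3
    define N where "N = real (m + l)"
    define x where "x = N * t / m"
    define y where "y = N * (1 - t) / l"
    have x: "0 \<le> x" and y: "0 \<le> y" using t by (auto simp: x_def y_def N_def)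
    have "x ^ m * y ^ l \<le> exp (x - 1) ^ m * exp (y - 1) ^ l"
      using x y exp_ge_add_one_self[of "x - 1"] exp_ge_add_one_self[of "y - 1"]
      by (intro mult_mono power_mono) auto
    also have "\<dots> = exp (m * (x - 1) + l * (y - 1))"
      by (simp add: exp_add flip: exp_of_nat_mult)
    also have "m * (x - 1) + l * (y - 1) = 0"
      using 3 by (simp add: x_def y_def N_def field_simps)
    finally have "x ^ m * y ^ l \<le> 1" by simp
    then have "x ^ m * y ^ l * (real m ^ m * real l ^ l) \<le> real m ^ m * real l ^ l"
      using mult_right_mono[of "x ^ m * y ^ l" 1 "real m ^ m * real l ^ l"] by simp
    also have "x ^ m * y ^ l * (real m ^ m * real l ^ l) = (x * m) ^ m * (y * l) ^ l"
      by (simp add: power_mult_distrib)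
    also have "x * m = N * t" using 3 by (simp add: x_def)
    also have "y * l = N * (1 - t)" using 3 by (simp add: y_def)
    finally show ?thesis by (simp add: N_def power_mult_distrib power_add mult_ac)
  qed
qed

lemma pochhammer_eq_Gamma_ratio:
  fixes a :: real
  assumes "a > 0"
  shows "pochhammer a n = Gamma (a + n) / Gamma a"
  using assms by (intro pochhammer_Gamma) (auto elim!: nonpos_Ints_cases')

text \<open>The ratio on the left is the mean of \<open>t ^ m * (1 - t) ^ l\<close> under the Beta distribution with
  parameters \<open>a\<close> and \<open>b\<close>, hence at most the maximum of that function.\<close>
lemma pochhammer_mult_le:
  fixes a b :: real
  assumes a: "a > 0" and b: "b > 0"
  shows "pochhammer a m * pochhammer b l * real (m + l) ^ (m + l)
    \<le> real m ^ m * real l ^ l * pochhammer (a + b) (m + l)"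
proof -
  define N where "N = real (m + l) ^ (m + l)"
  define C where "C = real m ^ m * real l ^ l"
  have I: "((\<lambda>t. C * (t powr (a - 1) * (1 - t) powr (b - 1))) has_integral C * Beta a b) {0..1}"
    by (intro has_integral_mult_right has_integral_Beta_real a b)
  have J: "((\<lambda>t. N * (t powr (a + m - 1) * (1 - t) powr (b + l - 1))) has_integral
      N * Beta (a + m) (b + l)) {0..1}"
    using a b by (intro has_integral_mult_right has_integral_Beta_real) auto
  have "N * Beta (a + m) (b + l) \<le> C * Beta a b"
  proof (rule has_integral_le[OF J I])
    fix t :: real
    assume t: "t \<in> {0..1}"
    \<comment> \<open>At \<open>t = 0\<close> both sides vanish, because \<open>0 powr x = 0\<close>
      for every \<open>x\<close>.\<close>
    have "t powr (a + m - 1) = t ^ m * t powr (a - 1)"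
    proof (cases "t = 0")
      case False
      then show ?thesis using t by (simp add: powr_diff powr_add powr_realpow)
    qed simp
    moreover have "(1 - t) powr (b + l - 1) = (1 - t) ^ l * (1 - t) powr (b - 1)"
    proof (cases "t = 1")
      case False
      then show ?thesis using t by (simp add: powr_diff powr_add powr_realpow)
    qed simp
    ultimately have "N * (t powr (a + m - 1) * (1 - t) powr (b + l - 1))
        = (t ^ m * (1 - t) ^ l * N) * (t powr (a - 1) * (1 - t) powr (b - 1))"
      by simp
    also have "\<dots> \<le> C * (t powr (a - 1) * (1 - t) powr (b - 1))"
      unfolding N_def C_def using t by (intro mult_right_mono power_mult_power_le) auto
    finally show "N * (t powr (a + m - 1) * (1 - t) powr (b + l - 1))
        \<le> C * (t powr (a - 1) * (1 - t) powr (b - 1))" .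
  qed
  moreover have "a + m + (b + l) = a + b + (m + l)" by simp
  ultimately have "N * (Gamma (a + m) * Gamma (b + l)) * Gamma (a + b)
      \<le> C * (Gamma a * Gamma b) * Gamma (a + b + (m + l))"
    using a b Gamma_real_pos[of "a + b"] Gamma_real_pos[of "a + b + (m + l)"]
    by (simp add: Beta_def divide_simps mult_ac)
  then show ?thesis
    using a b Gamma_real_pos[of a] Gamma_real_pos[of b] Gamma_real_pos[of "a + b"]
    by (simp add: pochhammer_eq_Gamma_ratio N_def C_def divide_simps mult_ac)
qed

text \<open>The Dirichlet case reduces to the Beta case: the new category \<open>x\<close> competes
  with all of \<open>F\<close> lumped into one category. The induction starts at a singleton, since
  the lumped parameter must be positive.\<close>

lemma sum_ln_pochhammer_le:
  fixes a :: "'k \<Rightarrow> real" and m :: "'k \<Rightarrow> nat"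
  assumes "finite K" "K \<noteq> {}" "\<And>k. k \<in> K \<Longrightarrow> a k > 0"
  shows "(\<Sum>k\<in>K. ln (pochhammer (a k) (m k)) - m k * ln (m k))
    \<le> ln (pochhammer (sum a K) (sum m K)) - real (sum m K) * ln (real (sum m K))"
  using assms
proof (induction K rule: finite_ne_induct)
  case (insert x F)
  define A where "A = sum a F"
  define M where "M = sum m F"
  have "A > 0" unfolding A_def using insert by (intro sum_pos) auto
  have ax: "a x > 0" using insert by auto
  have lnpow: "ln (real n ^ n) = n * ln n" for n
    by (cases "n = 0") (auto simp: ln_realpow)
  have pos: "real n ^ n > 0" for n by (cases "n = 0") auto
  have P: "pochhammer (a x) k > 0" "pochhammer A k > 0" "pochhammer (a x + A) k > 0" for k
    using ax \<open>A > 0\<close> by (auto intro: pochhammer_pos)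
  have "ln (pochhammer (a x) (m x) * pochhammer A M * real (m x + M) ^ (m x + M))
      \<le> ln (real (m x) ^ m x * real M ^ M * pochhammer (a x + A) (m x + M))"
    using pochhammer_mult_le[OF ax \<open>A > 0\<close>, of "m x" M] P pos
    by (subst ln_le_cancel_iff) (auto intro!: mult_pos_pos simp del: of_nat_add)
  then have "ln (pochhammer (a x) (m x)) + ln (pochhammer A M) + ln (real (m x + M) ^ (m x + M))
      \<le> ln (real (m x) ^ m x) + ln (real M ^ M) + ln (pochhammer (a x + A) (m x + M))"
    using P pos pos[of "m x + M"] by (simp add: ln_mult less_imp_neq[THEN not_sym] del: of_nat_add)
  moreover have "(\<Sum>k\<in>F. ln (pochhammer (a k) (m k)) - m k * ln (m k))
      \<le> ln (pochhammer A M) - real M * ln (real M)"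
    unfolding A_def M_def using insert by auto
  ultimately show ?case
    using insert unfolding A_def[symmetric] M_def[symmetric]
    by (simp add: lnpow A_def[symmetric] M_def[symmetric] del: of_nat_add of_nat_sum)
qed simp

lemma max_loglik_eq:
  assumes "finite K"
  shows "max_loglik K m
    = (\<Sum>k\<in>K. m k * ln (m k)) - real (sum m K) * ln (real (sum m K))"
proof -
  have "real (m k) * ln (real (m k) / real (sum m K))
      = m k * ln (m k) - m k * ln (real (sum m K))" if "k \<in> K" for k
  proof (cases "m k = 0")
    case False
    then have "sum m K > 0" using that assms by (metis not_gr_zero sum_eq_0_iff)
    with False have "ln (real (m k) / real (sum m K)) = ln (m k) - ln (real (sum m K))"
      by (intro ln_divide_pos) (auto simp del: of_nat_sum)
    then show ?thesis by (simp add: right_diff_distrib del: of_nat_sum)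
  qed simp
  then show ?thesis
    by (simp add: max_loglik_def sum_subtractf flip: sum_distrib_right)
qed

text \<open>The left side is the log-probability of one ordered sequence with counts
  \<open>m\<close> under a Polya urn with initial weights \<open>a\<close>.\<close>

lemma sum_ln_pochhammer_le_max_loglik:
  fixes a :: "'k \<Rightarrow> real" and m :: "'k \<Rightarrow> nat"
  assumes "finite K" "K \<noteq> {}" "\<And>k. k \<in> K \<Longrightarrow> a k > 0"
  shows "(\<Sum>k\<in>K. ln (pochhammer (a k) (m k))) - ln (pochhammer (sum a K) (sum m K))
    \<le> max_loglik K m"
  using sum_ln_pochhammer_le[of K a m, OF assms] assms(1) by (simp add: max_loglik_eq sum_subtractf)

text \<open>Gibbs' inequality, from \<open>ln x \<le> x - 1\<close> at the ratio of
  \<open>\<theta> k\<close> to the observed frequency. Positivity at observed categories matters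
  because \<open>ln 0\<close> is a real number here, not minus infinity.\<close>

lemma sum_mult_ln_le_max_loglik:
  fixes \<theta> :: "'k \<Rightarrow> real"
  assumes K: "finite K" and nonneg: "\<And>k. k \<in> K \<Longrightarrow> \<theta> k \<ge> 0" and le: "sum \<theta> K \<le> 1"
    and pos: "\<And>k. k \<in> K \<Longrightarrow> m k > 0 \<Longrightarrow> \<theta> k > 0"
  shows "(\<Sum>k\<in>K. m k * ln (\<theta> k)) \<le> max_loglik K m"
proof -
  define N where "N = real (sum m K)"
  have "m k * ln (\<theta> k) - m k * ln (m k / N) \<le> N * \<theta> k - m k" if k: "k \<in> K" for k
  proof (cases "m k = 0")
    case True
    then show ?thesis using nonneg[OF k] by (simp add: N_def sum_nonneg)
  next
    case False
    then have N: "N > 0" unfolding N_def using K k by (metis not_gr_zero of_nat_0_less_iff sum_eq_0_iff)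
    have t: "\<theta> k > 0" using pos k False by auto
    have "ln (\<theta> k) - ln (m k / N) = ln (N * \<theta> k / m k)"
      using t N False by (simp add: ln_div ln_mult)
    also have "\<dots> \<le> N * \<theta> k / m k - 1"
      using t N False by (intro ln_le_minus_one) auto
    finally have "m k * (ln (\<theta> k) - ln (m k / N)) \<le> m k * (N * \<theta> k / m k - 1)"
      by (intro mult_left_mono) auto
    also have "\<dots> = N * \<theta> k - m k" using False by (simp add: field_simps)
    finally show ?thesis by (simp add: algebra_simps)
  qed
  then have "(\<Sum>k\<in>K. m k * ln (\<theta> k) - m k * ln (m k / N)) \<le> (\<Sum>k\<in>K. N * \<theta> k - m k)"
    by (rule sum_mono)
  also have "\<dots> = N * sum \<theta> K - N" by (simp add: sum_subtractf sum_distrib_left N_def)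
  also have "\<dots> \<le> 0" using le mult_left_mono[of "sum \<theta> K" 1 N] by (simp add: N_def sum_nonneg)
  finally show ?thesis by (simp add: max_loglik_def N_def sum_subtractf)
qed

text \<open>The pooled frequencies \<open>\<theta>\<close> are one candidate distribution for each
  group, and each group's own optimum is at least as good.\<close>

lemma max_loglik_sum_le:
  assumes K: "finite K" and J: "finite J"
  shows "max_loglik K (\<lambda>k. \<Sum>j\<in>J. m j k) \<le> (\<Sum>j\<in>J. max_loglik K (m j))"
proof -
  define M where "M k = (\<Sum>j\<in>J. m j k)" for k
  define \<theta> where "\<theta> k = real (M k) / real (sum M K)" for k
  have "max_loglik K M = (\<Sum>k\<in>K. \<Sum>j\<in>J. m j k * ln (\<theta> k))"
    by (simp add: max_loglik_def \<theta>_def M_def sum_distrib_right)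
  also have "\<dots> = (\<Sum>j\<in>J. \<Sum>k\<in>K. m j k * ln (\<theta> k))" by (rule sum.swap)
  also have "\<dots> \<le> (\<Sum>j\<in>J. max_loglik K (m j))"
  proof (intro sum_mono sum_mult_ln_le_max_loglik K)
    show "\<theta> k \<ge> 0" for k by (simp add: \<theta>_def del: of_nat_sum)
    show "sum \<theta> K \<le> 1"
    proof -
      \<comment> \<open>The quotient is 1, or 0 if there are no data.\<close>
      have "sum \<theta> K = real (sum M K) / real (sum M K)"
        by (simp add: \<theta>_def flip: sum_divide_distrib)
      then show ?thesis by simp
    qed
    show "\<theta> k > 0" if "j \<in> J" "k \<in> K" "m j k > 0" for j k
    proof -
      have "M k > 0" unfolding M_def using that J by (metis not_gr_zero sum_eq_0_iff)
      moreover from this have "sum M K > 0" using that K by (metis not_gr_zero sum_eq_0_iff)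
      ultimately show ?thesis by (simp add: \<theta>_def del: of_nat_sum)
    qed
  qed
  finally show ?thesis by (simp add: M_def[abs_def])
qed

lemma max_loglik_nonpos:
  assumes "finite K"
  shows "max_loglik K m \<le> 0"
  unfolding max_loglik_def
proof (rule sum_nonpos)
  fix k assume k: "k \<in> K"
  have "m k \<le> sum m K" using assms k by (intro member_le_sum) auto
  then have "ln (real (m k) / real (sum m K)) \<le> 0" if "m k > 0"
    using that by (simp add: ln_le_zero_iff del: of_nat_sum)
  then show "real (m k) * ln (real (m k) / real (sum m K)) \<le> 0"
    by (cases "m k = 0") (auto intro!: mult_nonneg_nonpos)
qed

lemma h_fun_eq:
  assumes "finite K" "K \<noteq> {}" "\<alpha> > 0"
  shows "h_fun K m \<alpha>
    = (\<Sum>k\<in>K. ln (pochhammer (\<alpha> / card K) (m k))) - ln (pochhammer \<alpha> (sum m K))"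
proof -
  have "\<alpha> / card K > 0" using assms by (simp add: card_gt_0_iff)
  with assms show ?thesis
    by (simp add: h_fun_def Gamma_ratio_def pochhammer_eq_Gamma_ratio add.commute)
qed

lemma h_fun_le_max_loglik:
  assumes "finite K" "K \<noteq> {}" "\<alpha> > 0"
  shows "h_fun K m \<alpha> \<le> max_loglik K m"
  using sum_ln_pochhammer_le_max_loglik[of K "\<lambda>_. \<alpha> / card K" m] assms
  by (simp add: h_fun_eq card_gt_0_iff)

text \<open>A Polya urn: the part \<open>m'\<close> of the data updates the parameters, and the conditional
  probability of the rest is at most its maximum likelihood.\<close>
lemma h_fun_add_le:
  assumes K: "finite K" "K \<noteq> {}" and "\<alpha> > 0"
  shows "h_fun K (\<lambda>k. m k + m' k) \<alpha> \<le> h_fun K m \<alpha> + max_loglik K m'"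
proof -
  define b where "b = \<alpha> / card K"
  have b: "b > 0" using assms by (simp add: b_def card_gt_0_iff)
  \<comment> \<open>The chain rule of the urn: after \<open>p\<close> draws the weight
    \<open>x\<close> has become \<open>x + p\<close>.\<close>
  have P: "ln (pochhammer x (p + r)) = ln (pochhammer x p) + ln (pochhammer (x + p) r)"
    if "x > 0" for x :: real and p r :: nat
    using that by (simp add: pochhammer_product' ln_mult pochhammer_pos less_imp_neq[THEN not_sym]
        add_pos_nonneg)
  have S: "(\<Sum>k\<in>K. b + m k) = \<alpha> + real (sum m K)"
    using K by (simp add: b_def sum.distrib)
  show ?thesis
    using sum_ln_pochhammer_le_max_loglik[of K "\<lambda>k. b + m k" m'] assms b
    unfolding S h_fun_eq[OF assms] b_def[symmetric]
    by (simp add: P sum.distrib add_pos_nonneg)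
qed

text \<open>The data of \<open>j\<close> are drawn first; the rest is bounded by the maximum
  likelihood of each remaining group separately.\<close>

lemma h_fun_sum_le:
  assumes K: "finite K" "K \<noteq> {}" and "\<alpha> > 0" and J: "finite J" "j \<in> J"
  shows "h_fun K (\<lambda>k. \<Sum>j\<in>J. m j k) \<alpha>
    \<le> h_fun K (m j) \<alpha> + (\<Sum>j'\<in>J - {j}. max_loglik K (m j'))"
proof -
  have "h_fun K (\<lambda>k. \<Sum>j\<in>J. m j k) \<alpha> = h_fun K (\<lambda>k. m j k + (\<Sum>j'\<in>J - {j}. m j' k)) \<alpha>"
    using J by (simp add: sum.remove)
  also have "\<dots> \<le> h_fun K (m j) \<alpha> + max_loglik K (\<lambda>k. \<Sum>j'\<in>J - {j}. m j' k)"
    by (rule h_fun_add_le) fact+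
  also have "\<dots> \<le> h_fun K (m j) \<alpha> + (\<Sum>j'\<in>J - {j}. max_loglik K (m j'))"
    using max_loglik_sum_le[of K "J - {j}" m] K J by simp
  finally show ?thesis .
qed

subsection \<open>The bounds on a single count vector\<close>

lemma pochhammer_mono:
  fixes a b :: real
  assumes "0 < a" "a \<le> b"
  shows "pochhammer a n \<le> pochhammer b n"
  unfolding pochhammer_prod using assms by (intro prod_mono) auto

text \<open>After \<open>s\<close> draws, a new state first appears with probability
  \<open>(\<alpha> / q) / (\<alpha> + s)\<close>, and its repetitions have probability at most 1.
  This costs \<open>ln q + ln (1 + s / \<alpha>)\<close>, where \<open>s\<close> is at least the
  count of the preceding state. The last count precedes nothing, hence
  \<open>butlast\<close>.\<close>

lemma sum_list_ln_pochhammer_le: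
  fixes \<alpha> q :: real
  assumes \<alpha>: "\<alpha> > 0" and q: "q \<ge> 1" and pos: "\<forall>x\<in>set xs. x > 0"
  shows "(\<Sum>x\<leftarrow>xs. ln (pochhammer (\<alpha> / q) x)) - ln (pochhammer \<alpha> (sum_list xs))
    \<le> - real (length xs) * ln q - (\<Sum>x\<leftarrow>butlast xs. ln (1 + real x / \<alpha>))"
  using pos
proof (induction xs rule: rev_induct)
  case (snoc x ys)
  define s where "s = sum_list ys"
  obtain r where r: "x = Suc r" using snoc.prems by (cases x) auto
  have "\<alpha> / q \<le> \<alpha> + s"
    using \<alpha> q by (simp add: field_simps add_increasing2 mult_le_cancel_left1)
  have "pochhammer (\<alpha> / q) x \<le> \<alpha> / q * pochhammer (\<alpha> + s + 1) r"
    unfolding r pochhammer_rec using \<alpha> q \<open>\<alpha> / q \<le> \<alpha> + s\<close>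
    by (intro mult_left_mono pochhammer_mono) (auto simp: add_pos_nonneg)
  also have "\<dots> = (\<alpha> / (\<alpha> + s) / q) * pochhammer (\<alpha> + s) x"
    using \<alpha> by (simp add: r pochhammer_rec add_pos_nonneg less_imp_neq[THEN not_sym])
  finally have "ln (pochhammer (\<alpha> / q) x) \<le> ln ((\<alpha> / (\<alpha> + s) / q) * pochhammer (\<alpha> + s) x)"
    using \<alpha> q by (subst ln_le_cancel_iff)
      (auto intro!: mult_pos_pos divide_pos_pos pochhammer_pos add_pos_nonneg)
  also have "\<dots> = ln (pochhammer (\<alpha> + s) x) - ln q - ln ((\<alpha> + s) / \<alpha>)"
    using \<alpha> q pochhammer_pos[of "\<alpha> + s" x]
    by (simp add: ln_mult ln_div add_pos_nonneg less_imp_neq[THEN not_sym])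
  also have "(\<alpha> + s) / \<alpha> = 1 + s / \<alpha>" using \<alpha> by (simp add: field_simps)
  finally have step: "ln (pochhammer (\<alpha> / q) x) - ln (pochhammer (\<alpha> + s) x)
    \<le> - ln q - ln (1 + s / \<alpha>)" by simp
  \<comment> \<open>Appending \<open>x\<close> brings the last entry of \<open>ys\<close> into the
    \<open>butlast\<close> sum; that entry is at most \<open>s\<close>. For empty \<open>ys\<close>
    the extra term is \<open>ln 1\<close>.\<close>
  have last: "(\<Sum>x\<leftarrow>ys. ln (1 + real x / \<alpha>))
      \<le> (\<Sum>x\<leftarrow>butlast ys. ln (1 + real x / \<alpha>)) + ln (1 + s / \<alpha>)"
  proof (cases ys rule: rev_cases)
    case (snoc zs y)
    have "ln (1 + y / \<alpha>) \<le> ln (1 + s / \<alpha>)"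
      using \<alpha> by (subst ln_le_cancel_iff)
        (auto simp: s_def snoc divide_right_mono intro!: add_pos_nonneg)
    then show ?thesis by (simp add: snoc)
  qed (use \<alpha> in \<open>simp add: s_def\<close>)
  have "pochhammer \<alpha> (s + x) = pochhammer \<alpha> s * pochhammer (\<alpha> + s) x"
    by (simp add: pochhammer_product')
  then have "ln (pochhammer \<alpha> (s + x)) = ln (pochhammer \<alpha> s) + ln (pochhammer (\<alpha> + s) x)"
    using \<alpha> pochhammer_pos[of \<alpha> s] pochhammer_pos[of "\<alpha> + s" x]
    by (simp add: ln_mult add_pos_nonneg less_imp_neq[THEN not_sym])
  then show ?case
    using step last snoc.IH snoc.prems by (simp add: s_def[symmetric] algebra_simps)
qed simp

lemma sorted_desc_eq_filter_append_zeros: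
  fixes xs :: "nat list"
  assumes "sorted_wrt (\<ge>) xs"
  shows "\<exists>z. xs = filter (\<lambda>x. x > 0) xs @ replicate z 0"
  using assms
proof (induction xs)
  case (Cons x xs)
  then obtain z where z: "xs = filter (\<lambda>x. x > 0) xs @ replicate z 0" by auto
  show ?case
  proof (cases "x > 0")
    case True
    then show ?thesis using z by auto
  next
    case False
    then have "\<forall>y\<in>set xs. y = 0" using Cons.prems by auto
    then have "xs = replicate (length xs) 0" and "filter (\<lambda>x. x > 0) xs = []"
      by (auto simp: replicate_length_same filter_empty_conv)
    with False show ?thesis by (intro exI[of _ "Suc (length xs)"]) simp
  qed
qed simp

lemma sum_list_filter_pos:
  fixes F :: "nat \<Rightarrow> 'b :: comm_monoid_add"
  assumes "F 0 = 0"
  shows "(\<Sum>x\<leftarrow>filter (\<lambda>x. x > 0) xs. F x) = (\<Sum>x\<leftarrow>xs. F x)"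
  using assms by (induction xs) auto

lemma sum_list_sorted_cnts:
  fixes F :: "nat \<Rightarrow> 'b :: comm_monoid_add"
  shows "(\<Sum>x\<leftarrow>sorted_cnts c i D S j. F x) = (\<Sum>k\<in>c i. F (cnt_child D i S j k))"
proof -
  have "mset (sorted_cnts c i D S j) = image_mset (cnt_child D i S j) (mset_set (c i))"
    by (simp add: sorted_cnts_def)
  then show ?thesis
    by (simp add: sum_unfold_sum_mset image_mset.compositionality o_def
        flip: sum_mset_sum_list mset_map[symmetric])
qed

text \<open>In the decreasing list the positive counts form the prefix \<open>ys\<close>, so
  \<open>g_bound\<close> omits only the smallest of them. A positive total makes the set under
  \<open>Max\<close> in \<open>last_pos\<close> nonempty.\<close>

lemma sorted_cnts_bound:
  assumes K: "finite (c i)" and pos: "(\<Sum>k\<in>c i. cnt_child D i S j k) > 0"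
  defines "ys \<equiv> filter (\<lambda>x. x > 0) (sorted_cnts c i D S j)"
  shows "last_pos c i D S j = length ys"
    and "g_bound c i D S j \<alpha> = - (\<Sum>x\<leftarrow>butlast ys. ln (1 + real x / \<alpha>))"
proof -
  let ?L = "sorted_cnts c i D S j"
  have "sorted_wrt (\<ge>) ?L"
    by (simp add: sorted_cnts_def sorted_wrt_rev)
  then obtain z where z: "?L = ys @ replicate z 0"
    using sorted_desc_eq_filter_append_zeros unfolding ys_def by blast
  have len: "length ?L = card (c i)"
    by (simp add: sorted_cnts_def flip: size_mset)
  have "sum_list ?L = (\<Sum>k\<in>c i. cnt_child D i S j k)"
    using sum_list_sorted_cnts[of "\<lambda>x. x" c i D S j] by simp
  with pos have "sum_list ?L > 0" by simp
  then have "ys \<noteq> []" using z by (metis append_Nil less_irrefl sum_list_replicate mult_0_right)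
  have "{l \<in> {1..card (c i)}. ?L ! (l - 1) > 0} = {1..length ys}"
  proof -
    have "length ys \<le> card (c i)" using len z by (metis length_append le_add1)
    moreover have "?L ! (l - 1) > 0" if "1 \<le> l" "l \<le> length ys" for l
    proof -
      have "ys ! (l - 1) \<in> set ys" using that by (intro nth_mem) auto
      then have "ys ! (l - 1) > 0" by (simp add: ys_def)
      with that show ?thesis by (simp add: z nth_append)
    qed
    moreover have "?L ! (l - 1) = 0" if "length ys < l" "l \<le> card (c i)" for l
      using that len z by (auto simp: nth_append)
    ultimately have "l \<le> card (c i) \<and> ?L ! (l - 1) > 0 \<longleftrightarrow> l \<le> length ys" if "1 \<le> l" for l
      using that by (metis le_trans less_irrefl not_le)
    then show ?thesis by (simp add: set_eq_iff) blast
  qed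
  then show p: "last_pos c i D S j = length ys"
    using \<open>ys \<noteq> []\<close> by (simp add: last_pos_def Max_eq_iff Suc_le_eq)
  have "(\<Sum>x\<leftarrow>butlast ys. ln (1 + real x / \<alpha>))
      = (\<Sum>l<length ys - 1. ln (1 + real (?L ! l) / \<alpha>))"
    by (auto simp: sum_list_sum_nth atLeast0LessThan z nth_append nth_butlast intro!: sum.cong)
  then show "g_bound c i D S j \<alpha> = - (\<Sum>x\<leftarrow>butlast ys. ln (1 + real x / \<alpha>))"
    by (simp add: g_bound_def p sum.atLeast1_atMost_eq)
qed

text \<open>Zero counts contribute nothing to \<open>h_fun\<close>, so the list bound is applied to
  the positive counts only; \<open>f_bound\<close> counts exactly these.\<close>

lemma h_fun_le_f_bound_plus_g_bound:
  assumes K: "finite (c i)" "c i \<noteq> {}" and \<alpha>: "\<alpha> > 0"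
    and pos: "(\<Sum>k\<in>c i. cnt_child D i S j k) > 0"
    and card: "card (uniq_ext D i S j) = card {k \<in> c i. cnt_child D i S j k > 0}"
  shows "h_fun (c i) (cnt_child D i S j) \<alpha> \<le> f_bound c i D S j + g_bound c i D S j \<alpha>"
proof -
  let ?m = "cnt_child D i S j"
  define ys where "ys = filter (\<lambda>x. x > 0) (sorted_cnts c i D S j)"
  \<comment> \<open>As a sum of indicators that vanish at 0, the length can be computed over the
    unfiltered list.\<close>
  have "length (filter (\<lambda>x. x > 0) xs) = (\<Sum>x\<leftarrow>filter (\<lambda>x. x > 0) xs. of_bool (x > 0))"
    for xs :: "nat list" by (induction xs) auto
  then have "length ys = (\<Sum>x\<leftarrow>ys. of_bool (x > 0))" unfolding ys_def .
  also have "\<dots> = card {k \<in> c i. ?m k > 0}"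
    unfolding ys_def using K by (simp add: sum_list_filter_pos sum_list_sorted_cnts Int_def)
  finally have len: "length ys = card (uniq_ext D i S j)" using card by simp
  have "sum_list ys = sum ?m (c i)"
    using sum_list_sorted_cnts[of "\<lambda>x. x" c i D S j]
      sum_list_filter_pos[of "\<lambda>x. x" "sorted_cnts c i D S j"]
    by (simp add: ys_def)
  moreover have "(\<Sum>x\<leftarrow>ys. ln (pochhammer (\<alpha> / card (c i)) x))
      = (\<Sum>k\<in>c i. ln (pochhammer (\<alpha> / card (c i)) (?m k)))"
    unfolding ys_def by (simp add: sum_list_filter_pos sum_list_sorted_cnts)
  moreover have "real (card (c i)) \<ge> 1" using K by (simp add: Suc_le_eq card_gt_0_iff)
  ultimately show ?thesis
    using sum_list_ln_pochhammer_le[of \<alpha> "card (c i)" ys] \<alpha> K len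
      sorted_cnts_bound(2)[of c i D S j \<alpha>] pos
    by (auto simp: h_fun_eq f_bound_def ys_def)
qed

text \<open>Carries the bound from the parameter of \<open>T\<close> to the parameter of
  \<open>S\<close>, which is at least as large.\<close>

lemma g_bound_mono:
  assumes "0 < \<alpha>" "\<alpha> \<le> \<beta>"
  shows "g_bound c i D S j \<alpha> \<le> g_bound c i D S j \<beta>"
  unfolding g_bound_def neg_le_iff_le
proof (rule sum_mono)
  fix l
  have "real x / \<beta> \<le> real x / \<alpha>" for x
    using assms by (intro divide_left_mono) auto
  then show "ln (1 + real (sorted_cnts c i D S j ! (l - 1)) / \<beta>)
      \<le> ln (1 + real (sorted_cnts c i D S j ! (l - 1)) / \<alpha>)"
    using assms by (subst ln_le_cancel_iff) (auto intro!: add_pos_nonneg)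
qed

section \<open>The sign of the derivative of \<open>h_fun\<close>\<close>

text \<open>The induction removes a largest \<open>m k\<close>, for which \<open>card K * m k\<close> is at least the total.\<close>
lemma sum_antimono_multiples_le:
  fixes v :: "nat \<Rightarrow> real"
  assumes K: "finite K" and v: "\<And>s t. 1 \<le> s \<Longrightarrow> s \<le> t \<Longrightarrow> v t \<le> v s"
  shows "(\<Sum>k\<in>K. \<Sum>t=1..m k. v (card K * t)) \<le> (\<Sum>s=1..sum m K. v s)"
proof (induction "sum m K" arbitrary: m)
  case 0
  then show ?case using K by simp
next
  case (Suc N)
  then have "K \<noteq> {}" by auto
  obtain k where k: "k \<in> K" "\<And>k'. k' \<in> K \<Longrightarrow> m k' \<le> m k"
    using obtains_MAX[OF K \<open>K \<noteq> {}\<close>, of m] K by (metis Max_ge finite_imageI imageI)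
  have "Suc N \<le> card K * m k"
    using Suc.hyps(2) sum_bounded_above[of K m "m k"] k by simp
  then obtain r where r: "m k = Suc r" by (cases "m k") auto
  define m' where "m' = m(k := r)"
  have "sum m K = m k + sum m (K - {k})" "sum m' K = m' k + sum m' (K - {k})"
    using k K by (auto intro: sum.remove)
  moreover have "sum m' (K - {k}) = sum m (K - {k})" by (intro sum.cong) (auto simp: m'_def)
  ultimately have N: "sum m' K = N" using Suc.hyps(2) r by (simp add: m'_def)
  have "(\<Sum>k\<in>K. \<Sum>t=1..m k. v (card K * t))
      = (\<Sum>t=1..Suc r. v (card K * t)) + (\<Sum>k\<in>K - {k}. \<Sum>t=1..m k. v (card K * t))"
    using k K r by (simp add: sum.remove)
  also have "(\<Sum>k\<in>K - {k}. \<Sum>t=1..m k. v (card K * t))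
      = (\<Sum>k\<in>K - {k}. \<Sum>t=1..m' k. v (card K * t))"
    by (intro sum.cong) (auto simp: m'_def)
  also have "(\<Sum>t=1..Suc r. v (card K * t)) + \<dots>
      = (\<Sum>k\<in>K. \<Sum>t=1..m' k. v (card K * t)) + v (card K * m k)"
    using k K by (simp add: sum.remove m'_def r)
  \<comment> \<open>The removed term is charged to the last term \<open>v (Suc N)\<close> on the
    right.\<close>
  also have "\<dots> \<le> (\<Sum>s=1..N. v s) + v (Suc N)"
    using Suc.hyps(1)[of m'] N v[of "Suc N" "card K * m k"] \<open>Suc N \<le> card K * m k\<close>
    by (intro add_mono) auto
  also have "\<dots> = (\<Sum>s=1..sum m K. v s)" by (simp flip: Suc.hyps(2))
  finally show ?case .
qed

text \<open>The derivative of \<open>h_fun\<close>, with the inner factor \<open>1 / card K\<close>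
  absorbed into the denominators: both sums then sample \<open>1 / (\<alpha> + t)\<close>, the first
  one at multiples of \<open>card K\<close>.\<close>

definition h_deriv :: "'a set \<Rightarrow> ('a \<Rightarrow> nat) \<Rightarrow> real \<Rightarrow> real" where
  "h_deriv K m \<alpha> = (\<Sum>k\<in>K. \<Sum>t<m k. 1 / (\<alpha> + real (card K * t))) - (\<Sum>t<sum m K. 1 / (\<alpha> + real t))"

lemma ln_pochhammer:
  fixes a :: real
  assumes "a > 0"
  shows "ln (pochhammer a n) = (\<Sum>t<n. ln (a + real t))"
  using assms by (simp add: pochhammer_prod ln_prod atLeast0LessThan add_pos_nonneg
      less_imp_neq[THEN not_sym])

lemma h_fun_has_derivative:
  assumes K: "finite K" "K \<noteq> {}" and \<alpha>: "\<alpha> > 0"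
  shows "(h_fun K m has_field_derivative h_deriv K m \<alpha>) (at \<alpha>)"
proof -
  define q where "q = real (card K)"
  have q: "q > 0" using K by (simp add: q_def card_gt_0_iff)
  have "((\<lambda>\<alpha>. (\<Sum>k\<in>K. \<Sum>t<m k. ln (\<alpha> / q + real t)) - (\<Sum>t<sum m K. ln (\<alpha> + real t)))
      has_field_derivative (\<Sum>k\<in>K. \<Sum>t<m k. 1 / q / (\<alpha> / q + real t)) - (\<Sum>t<sum m K. 1 / (\<alpha> + real t)))
      (at \<alpha>)"
    using \<alpha> q by (auto intro!: derivative_eq_intros add_pos_nonneg sum.cong
        simp: add_pos_nonneg less_imp_neq[THEN not_sym])
  also have "(\<Sum>k\<in>K. \<Sum>t<m k. 1 / q / (\<alpha> / q + real t)) - (\<Sum>t<sum m K. 1 / (\<alpha> + real t)) = h_deriv K m \<alpha>"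
    using q by (simp add: h_deriv_def q_def[symmetric] field_simps)
  finally show ?thesis
  proof (rule has_field_derivative_transform_within_open)
    show "open {0 :: real<..}" "\<alpha> \<in> {0<..}" using \<alpha> by auto
    fix x :: real
    assume "x \<in> {0<..}"
    then show "(\<Sum>k\<in>K. \<Sum>t<m k. ln (x / q + real t)) - (\<Sum>t<sum m K. ln (x + real t)) = h_fun K m x"
      using K q by (simp add: h_fun_eq ln_pochhammer q_def)
  qed
qed

text \<open>Up to the factor \<open>\<beta> - \<alpha>\<close>, the difference of the two sides
  compares sums of \<open>v\<close> over multiples of \<open>card K\<close> with the sum of
  \<open>v\<close> over all integers below the total. As \<open>v\<close> increases up to
  \<open>sqrt (\<alpha> * \<beta>)\<close> and decreases afterwards, \<open>\<beta> \<le> 1\<close>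
  makes it decreasing on the positive integers.\<close>

lemma mult_h_deriv_antimono:
  assumes K: "finite K" and \<alpha>: "0 < \<alpha>" "\<alpha> \<le> \<beta>" "\<beta> \<le> 1"
  shows "\<beta> * h_deriv K m \<beta> \<le> \<alpha> * h_deriv K m \<alpha>"
proof -
  define v where "v t = real t / ((\<alpha> + t) * (\<beta> + t))" for t :: nat
  have diff: "\<alpha> / (\<alpha> + real t) - \<beta> / (\<beta> + real t) = (\<alpha> - \<beta>) * v t" for t :: nat
    using \<alpha> unfolding v_def by (simp add: divide_simps add_pos_nonneg less_imp_neq[THEN not_sym])
      (simp add: algebra_simps)
  have "v 0 = 0" by (simp add: v_def)
  have v_nonneg: "v t \<ge> 0" for t using \<alpha> by (simp add: v_def)
  have v_antimono: "v t \<le> v s" if "1 \<le> s" "s \<le> t" for s t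
  proof -
    have "\<alpha> * \<beta> \<le> 1" using \<alpha> by (intro mult_le_one) auto
    also have "1 \<le> real s * real t" using that mult_mono[of 1 "real s" 1 "real t"] by simp
    \<comment> \<open>This product is the difference of the two sides of
      \<open>v t \<le> v s\<close> after clearing denominators.\<close>
    finally have "0 \<le> (real t - s) * (real s * t - \<alpha> * \<beta>)"
      using that by (intro mult_nonneg_nonneg) auto
    then have "real t * ((\<alpha> + s) * (\<beta> + s)) \<le> real s * ((\<alpha> + t) * (\<beta> + t))"
      by (simp add: algebra_simps)
    then show ?thesis
      using \<alpha> unfolding v_def by (simp add: divide_simps add_pos_nonneg mult_pos_pos)
  qed
  have shift: "(\<Sum>t<r. v (c * t)) = (\<Sum>t=1..r - 1. v (c * t))" for r c
  proof (cases r)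
    case (Suc r')
    show ?thesis
      unfolding Suc by (subst sum.lessThan_Suc_shift) (simp add: \<open>v 0 = 0\<close> sum.atLeast1_atMost_eq)
  qed simp
  \<comment> \<open>Each inner sum has lost its first term, the total sum only one; a single
    positive count is enough for the comparison.\<close>
  have le: "(\<Sum>k\<in>K. m k - 1) \<le> sum m K - 1"
  proof (cases "sum m K = 0")
    case False
    then obtain k where k: "k \<in> K" "m k > 0" using K by auto
    have "(\<Sum>k\<in>K. m k - 1) < sum m K"
      using K k by (intro sum_strict_mono_ex1) (auto intro!: bexI[of _ k])
    then show ?thesis by simp
  qed (use K in auto)
  have "(\<Sum>k\<in>K. \<Sum>t<m k. v (card K * t)) = (\<Sum>k\<in>K. \<Sum>t=1..m k - 1. v (card K * t))"
    by (simp add: shift)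
  also have "\<dots> \<le> (\<Sum>s=1..(\<Sum>k\<in>K. m k - 1). v s)"
    by (intro sum_antimono_multiples_le K v_antimono)
  also have "\<dots> \<le> (\<Sum>s=1..sum m K - 1. v s)"
    using le v_nonneg by (intro sum_mono2) auto
  also have "\<dots> = (\<Sum>s<sum m K. v s)" using shift[where c = 1] by simp
  finally have "0 \<le> (\<beta> - \<alpha>) * ((\<Sum>s<sum m K. v s) - (\<Sum>k\<in>K. \<Sum>t<m k. v (card K * t)))"
    using \<alpha> by simp
  also have "\<dots> = (\<Sum>k\<in>K. \<Sum>t<m k. \<alpha> / (\<alpha> + real (card K * t)) - \<beta> / (\<beta> + real (card K * t)))
      - (\<Sum>t<sum m K. \<alpha> / (\<alpha> + real t) - \<beta> / (\<beta> + real t))"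
    unfolding diff sum_distrib_left[symmetric] by (simp add: algebra_simps)
  also have "\<dots> = \<alpha> * h_deriv K m \<alpha> - \<beta> * h_deriv K m \<beta>"
    unfolding h_deriv_def by (simp add: sum_subtractf sum_distrib_left right_diff_distrib)
  finally show ?thesis by simp
qed

text \<open>In the first case of \<open>h_bar\<close> the sign of the derivative at
  \<open>\<beta>\<close> passes to all smaller parameters, so \<open>h_fun\<close> is nondecreasing
  up to \<open>\<beta>\<close>. In the other case 0 bounds any log-probability.\<close>

lemma h_fun_le_h_bar:
  assumes K: "finite K" "K \<noteq> {}" and \<alpha>: "0 < \<alpha>" "\<alpha> \<le> \<beta>"
  shows "h_fun K m \<alpha> \<le> h_bar K m \<beta>"
proof (cases "\<beta> \<le> 1 \<and> deriv (h_fun K m) \<beta> \<ge> 0")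
  case True
  have "\<beta> > 0" using \<alpha> by simp
  then have "deriv (h_fun K m) \<beta> = h_deriv K m \<beta>"
    using h_fun_has_derivative[OF K] by (intro DERIV_imp_deriv) auto
  with True have \<beta>: "\<beta> \<le> 1" "h_deriv K m \<beta> \<ge> 0" by auto
  have "h_fun K m \<alpha> \<le> h_fun K m \<beta>"
  proof (rule DERIV_nonneg_imp_nondecreasing[OF \<alpha>(2)])
    fix x assume x: "\<alpha> \<le> x" "x \<le> \<beta>"
    then have "x > 0" using \<alpha> by simp
    have "0 \<le> \<beta> * h_deriv K m \<beta>" using \<beta> \<open>\<beta> > 0\<close> by simp
    also have "\<dots> \<le> x * h_deriv K m x"
      using K x \<open>x > 0\<close> \<beta> by (intro mult_h_deriv_antimono) auto
    finally have "0 \<le> h_deriv K m x" using \<open>x > 0\<close> by (simp add: zero_le_mult_iff)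
    then show "\<exists>y. (h_fun K m has_real_derivative y) (at x) \<and> 0 \<le> y"
      using h_fun_has_derivative[OF K \<open>x > 0\<close>] by blast
  qed
  then show ?thesis using True by (simp add: h_bar_def)
next
  case False
  then show ?thesis
    using h_fun_le_max_loglik[OF K \<alpha>(1), of m] max_loglik_nonpos[OF K(1), of m]
    by (auto simp: h_bar_def)
qed

subsection \<open>Counts and projections\<close>

lemma cnt_child_eq:
  "cnt_child D i S j k = size {#x \<in># D. restrict x S = j \<and> x i = k#}"
proof -
  have "(S \<union> {i}) \<inter> S = S" by auto
  then show ?thesis by (simp add: cnt_child_def data_on_def filter_mset_image_mset)
qed

lemma cnt_eq: "cnt D S j = size {#x \<in># D. restrict x S = j#}"
  unfolding cnt_def data_on_def by (induction D) auto

lemma size_filter_mset_eq_sum: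
  assumes "finite A" "\<And>x. x \<in># D \<Longrightarrow> P x \<Longrightarrow> f x \<in> A"
  shows "size {#x \<in># D. P x#} = (\<Sum>a\<in>A. size {#x \<in># D. P x \<and> f x = a#})"
  using assms(2)
proof (induction D)
  case (add x D)
  have "size {#y \<in># add_mset x D. P y \<and> f y = a#}
      = of_bool (P x \<and> f x = a) + size {#y \<in># D. P y \<and> f y = a#}" for a
    by simp
  moreover have "(\<Sum>a\<in>A. of_bool (P x \<and> f x = a)) = (of_bool (P x) :: nat)"
    using assms(1) add.prems[of x] by (cases "P x") (auto simp: of_bool_def sum.delta)
  ultimately show ?case
    using add by (simp add: sum.distrib)
qed simp

lemma uniq_on_eq: "uniq_on D S = (\<lambda>x. restrict x S) ` set_mset D"
  by (simp add: uniq_on_def data_on_def)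

lemma finite_uniq_on [simp]: "finite (uniq_on D S)"
  by (simp add: uniq_on_eq)

lemma restrict_uniq_on:
  assumes "S \<subseteq> S'"
  shows "(\<lambda>j. restrict j S) ` uniq_on D S' = uniq_on D S"
  using assms by (simp add: uniq_on_eq image_image Int_absorb1)

lemma cnt_eq_sum_cnt_child:
  assumes "finite (c i)" "\<And>x. x \<in># D \<Longrightarrow> x i \<in> c i"
  shows "cnt D S j = (\<Sum>k\<in>c i. cnt_child D i S j k)"
  unfolding cnt_eq cnt_child_eq using assms by (intro size_filter_mset_eq_sum) auto

lemma cnt_child_pos_iff:
  "cnt_child D i S j k > 0 \<longleftrightarrow> (\<exists>x\<in>#D. restrict x S = j \<and> x i = k)"
  by (auto simp: cnt_child_eq simp flip: nonempty_has_size set_mset_eq_empty_iff)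

lemma cnt_child_eq_sum:
  assumes "S \<subseteq> W"
  shows "cnt_child D i S j k
    = (\<Sum>j'\<in>{j' \<in> uniq_on D W. restrict j' S = j}. cnt_child D i W j' k)"
proof -
  have "cnt_child D i S j k = (\<Sum>j'\<in>{j' \<in> uniq_on D W. restrict j' S = j}.
      size {#x \<in># D. (restrict x S = j \<and> x i = k) \<and> restrict x W = j'#})"
    unfolding cnt_child_eq using assms
    by (intro size_filter_mset_eq_sum) (auto simp: uniq_on_eq Int_absorb1)
  \<comment> \<open>A data row with \<open>W\<close>-part \<open>j'\<close> has
    \<open>S\<close>-part \<open>restrict j' S\<close>, which is already \<open>j\<close>.\<close>
  also have "\<dots> = (\<Sum>j'\<in>{j' \<in> uniq_on D W. restrict j' S = j}. cnt_child D i W j' k)"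
    unfolding cnt_child_eq using assms
    by (intro sum.cong arg_cong[where f = size] filter_mset_cong) (auto simp: Int_absorb1)
  finally show ?thesis .
qed

text \<open>An element with \<open>S\<close>-part \<open>j\<close> is determined by its value at
  \<open>i\<close>, so evaluation at \<open>i\<close> is a bijection onto the observed child
  states.\<close>

lemma card_uniq_ext:
  assumes "\<And>x. x \<in># D \<Longrightarrow> x i \<in> c i"
  shows "card (uniq_ext D i S j) = card {k \<in> c i. cnt_child D i S j k > 0}"
proof (rule bij_betw_same_card[of "\<lambda>x. x i"])
  have "inj_on (\<lambda>x. x i) (uniq_ext D i S j)"
  proof (rule inj_onI)
    fix x y
    assume xy: "x \<in> uniq_ext D i S j" "y \<in> uniq_ext D i S j" and i: "x i = y i"
    show "x = y"
    proof (rule extensionalityI[of _ "S \<union> {i}"])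
      show "x \<in> extensional (S \<union> {i})" "y \<in> extensional (S \<union> {i})"
        using xy by (auto simp: uniq_ext_def uniq_on_eq)
      fix v
      assume "v \<in> S \<union> {i}"
      moreover have "restrict x S = restrict y S" using xy by (simp add: uniq_ext_def)
      ultimately show "x v = y v" using i by (metis Un_iff restrict_apply' singletonD)
    qed
  qed
  moreover have "(\<lambda>x. x i) ` uniq_ext D i S j = {k \<in> c i. cnt_child D i S j k > 0}"
  proof -
    have "(S \<union> {i}) \<inter> S = S" by auto
    then have "uniq_ext D i S j = (\<lambda>x. restrict x (S \<union> {i})) ` {x \<in> set_mset D. restrict x S = j}"
      by (auto simp: uniq_ext_def uniq_on_eq)
    then have "(\<lambda>x. x i) ` uniq_ext D i S j = (\<lambda>x. x i) ` {x \<in> set_mset D. restrict x S = j}"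
      by (simp add: image_image)
    also have "\<dots> = {k \<in> c i. cnt_child D i S j k > 0}"
      using assms by (auto simp: cnt_child_pos_iff)
    finally show ?thesis .
  qed
  ultimately show "bij_betw (\<lambda>x. x i) (uniq_ext D i S j) {k \<in> c i. cnt_child D i S j k > 0}"
    by (simp add: bij_betw_def)
qed

lemma LLBDeu_eq_h_fun:
  assumes "finite (c i)" "\<And>x. x \<in># D \<Longrightarrow> x i \<in> c i"
  shows "LLBDeu c i D \<alpha>ess S j = h_fun (c i) (cnt_child D i S j) (\<alpha>ess / qsize c S)"
proof -
  have "cnt D S j = (\<Sum>k\<in>c i. cnt_child D i S j k)"
    using assms by (intro cnt_eq_sum_cnt_child)
  then show ?thesis by (simp add: LLBDeu_def h_fun_def)
qed

lemma qsize_pos: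
  assumes "finite S" "\<And>v. v \<in> S \<Longrightarrow> finite (c v) \<and> c v \<noteq> {}"
  shows "qsize c S > 0"
  using assms by (auto simp: qsize_def card_PiE card_gt_0_iff intro!: prod_pos)

lemma qsize_mono:
  assumes "finite T" "S \<subseteq> T" "\<And>v. v \<in> T \<Longrightarrow> finite (c v) \<and> c v \<noteq> {}"
  shows "qsize c S \<le> qsize c T"
proof -
  have "qsize c T = qsize c S * (\<Prod>v\<in>T - S. card (c v))"
    using assms finite_subset[of S T]
    by (simp add: qsize_def card_PiE prod.subset_diff[of S T] mult.commute)
  moreover have "(\<Prod>v\<in>T - S. card (c v)) > 0"
    using assms by (intro prod_pos) (auto simp: card_gt_0_iff)
  ultimately show ?thesis by simp
qed

section \<open>Combining the bounds below each configuration of \<open>S\<close>\<close>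

theorem mainTheorem4:
  fixes n i :: nat
    and V S T :: "nat set"
    and c :: "nat \<Rightarrow> 'a set"
    and D :: "(nat \<Rightarrow> 'a) multiset"
    and \<alpha>ess :: real
  assumes "V = {1..n}"
    and "i \<in> V"
    and "\<And>v. v \<in> V \<Longrightarrow> finite (c v) \<and> c v \<noteq> {}"
    and "set_mset D \<subseteq> Pi\<^sub>E V c"
    and "\<alpha>ess > 0"
    and "S \<subseteq> V - {i}"
    and "S \<subset> T"
    and "T \<subseteq> V - {i}"
  shows "ub_h V c i D \<alpha>ess S \<ge> LBDeu c i D \<alpha>ess T"
proof -
  define W where "W = V - {i}"
  define m where "m = cnt_child D i W"
  define L where "L j = max_loglik (c i) (m j)" for j
  \<comment> \<open>\<open>\<alpha>\<close> is the parameter in the score of \<open>T\<close>,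
    \<open>\<beta>\<close> the one used by \<open>ub_h\<close>; since \<open>T\<close> has at least
    as many configurations as \<open>S\<close>, \<open>\<alpha> \<le> \<beta>\<close>.\<close>
  define \<alpha> where "\<alpha> = \<alpha>ess / qsize c T"
  define \<beta> where "\<beta> = \<alpha>ess / qsize c S"
  define ext where "ext R j = {j' \<in> uniq_on D W. restrict j' R = j}" for R j
  have "finite V" using assms(1) by simp
  have ST: "S \<subseteq> T" and TW: "T \<subseteq> W" and SW: "S \<subseteq> W" and fin: "finite T" "finite S"
    using assms \<open>finite V\<close> by (auto simp: W_def intro: finite_subset)
  have states: "finite (c v) \<and> c v \<noteq> {}" if "v \<in> T" for v
    using assms(3,8) that by auto
  have ci: "finite (c i)" "c i \<noteq> {}" using assms(2,3) by auto
  have Di: "x i \<in> c i" if "x \<in># D" for x using assms(2,4) that by auto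
  have q: "qsize c S > 0" "qsize c T > 0" "qsize c S \<le> qsize c T"
    using fin ST states by (auto intro!: qsize_pos qsize_mono)
  have \<alpha>: "0 < \<alpha>" "\<alpha> \<le> \<beta>"
    using q assms(5) by (auto simp: \<alpha>_def \<beta>_def intro!: divide_left_mono)
  have finite_ext [simp]: "finite (ext R j)" for R j
    by (simp add: ext_def)
  have ext_nonempty: "ext R t \<noteq> {}" if t: "t \<in> uniq_on D R" and R: "R \<subseteq> W" for R t
  proof -
    have "t \<in> (\<lambda>j. restrict j R) ` uniq_on D W" using t restrict_uniq_on[OF R, of D] by simp
    then show ?thesis by (auto simp: ext_def)
  qed
  have LL: "LLBDeu c i D \<alpha>ess T jT = h_fun (c i) (\<lambda>k. \<Sum>j\<in>ext T jT. m j k) \<alpha>" for jT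
  proof -
    have "cnt_child D i T jT = (\<lambda>k. \<Sum>j\<in>ext T jT. m j k)"
      using cnt_child_eq_sum[OF TW, of D i jT] by (auto simp: m_def ext_def)
    moreover have "LLBDeu c i D \<alpha>ess T jT = h_fun (c i) (cnt_child D i T jT) \<alpha>"
      unfolding \<alpha>_def using ci Di by (intro LLBDeu_eq_h_fun)
    ultimately show ?thesis by simp
  qed
  have LL_le: "LLBDeu c i D \<alpha>ess T jT \<le> h_fun (c i) (m j) \<alpha> + (\<Sum>j'\<in>ext T jT - {j}. L j')"
    if "j \<in> ext T jT" for j jT
    unfolding LL L_def using that ci \<alpha> by (intro h_fun_sum_le) auto
  have h_le_L: "h_fun (c i) (m j) \<alpha> \<le> L j" for j
    unfolding L_def using ci \<alpha> by (intro h_fun_le_max_loglik) auto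
  have h_le: "h_fun (c i) (m j) \<alpha>
      \<le> Min {L j, f_bound c i D W j + g_bound c i D W j \<beta>, h_bar (c i) (m j) \<beta>}"
    if j: "j \<in> uniq_on D W" for j
  proof -
    \<comment> \<open>A data row showing \<open>j\<close> makes its total count positive.\<close>
    obtain x where x: "x \<in># D" "restrict x W = j" using j by (auto simp: uniq_on_eq)
    then have "m j (x i) > 0" unfolding m_def by (auto simp: cnt_child_pos_iff)
    then have "(\<Sum>k\<in>c i. m j k) > 0"
      using ci Di[OF x(1)] by (metis not_gr_zero sum_eq_0_iff)
    then have "h_fun (c i) (m j) \<alpha> \<le> f_bound c i D W j + g_bound c i D W j \<alpha>"
      unfolding m_def using ci \<alpha> Di by (intro h_fun_le_f_bound_plus_g_bound card_uniq_ext) auto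
    also have "\<dots> \<le> f_bound c i D W j + g_bound c i D W j \<beta>"
      using \<alpha> by (intro add_left_mono g_bound_mono)
    finally show ?thesis using h_le_L h_fun_le_h_bar[OF ci \<alpha>] by simp
  qed

  have main: "(\<Sum>jT\<in>{jT \<in> uniq_on D T. restrict jT S = jS}. LLBDeu c i D \<alpha>ess T jT)
      \<le> h_under V c i D \<alpha>ess S jS" if jS: "jS \<in> uniq_on D S" for jS
  proof -
    define B where "B j = - L j +
      Min {L j, f_bound c i D W j + g_bound c i D W j \<beta>, h_bar (c i) (m j) \<beta>}" for j
    define U where "U = {jT \<in> uniq_on D T. restrict jT S = jS}"
    have "finite U" by (simp add: U_def)
    have "ext S jS \<noteq> {}" using jS SW by (intro ext_nonempty)
    then have "Min (B ` ext S jS) \<in> B ` ext S jS" by (intro Min_in) simp_all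
    \<comment> \<open>The minimiser \<open>j\<close> is the configuration to single out; only the
      configuration \<open>jT\<close> of \<open>T\<close> that it extends receives the refined
      bound.\<close>
    then obtain j where B: "Min (B ` ext S jS) = B j" and j: "j \<in> ext S jS" by (rule imageE)
    have jW: "j \<in> uniq_on D W" using j by (simp add: ext_def)
    define jT where "jT = restrict j T"
    have jT: "jT \<in> U" "j \<in> ext T jT"
      using j restrict_uniq_on[OF TW, of D] ST
      by (auto simp: U_def jT_def ext_def Int_absorb1)
    \<comment> \<open>For every other configuration of \<open>T\<close>, an arbitrary extension is
      singled out and its \<open>h_fun\<close> bounded by \<open>L\<close>.\<close>
    have "(\<Sum>t\<in>U - {jT}. LLBDeu c i D \<alpha>ess T t) \<le> (\<Sum>t\<in>U - {jT}. \<Sum>j'\<in>ext T t. L j')"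
    proof (rule sum_mono)
      fix t assume "t \<in> U - {jT}"
      then obtain j' where j': "j' \<in> ext T t" using ext_nonempty[of t T] TW by (auto simp: U_def)
      then show "LLBDeu c i D \<alpha>ess T t \<le> (\<Sum>j'\<in>ext T t. L j')"
        using LL_le[OF j'] h_le_L[of j'] by (simp add: sum.remove)
    qed
    moreover have "LLBDeu c i D \<alpha>ess T jT \<le> (\<Sum>j'\<in>ext T jT. L j') - L j + h_fun (c i) (m j) \<alpha>"
      using LL_le[OF jT(2)] jT(2) by (simp add: sum.remove)
    ultimately have "(\<Sum>t\<in>U. LLBDeu c i D \<alpha>ess T t)
        \<le> (\<Sum>t\<in>U. \<Sum>j'\<in>ext T t. L j') - L j + h_fun (c i) (m j) \<alpha>"
      using \<open>finite U\<close> jT(1) by (simp add: sum.remove)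
    \<comment> \<open>The observed extensions of \<open>jS\<close> are partitioned by their
      \<open>T\<close>-parts.\<close>
    also have "(\<Sum>t\<in>U. \<Sum>j'\<in>ext T t. L j') = (\<Sum>j'\<in>ext S jS. L j')"
    proof -
      have "{j' \<in> ext S jS. restrict j' T = t} = ext T t" if "t \<in> U" for t
        using that ST by (auto simp: ext_def U_def Int_absorb1)
      moreover have "(\<lambda>j'. restrict j' T) ` ext S jS \<subseteq> U"
        using restrict_uniq_on[OF TW, of D] ST by (auto simp: ext_def U_def Int_absorb1)
      ultimately show ?thesis
        using sum.group[of "ext S jS" U "\<lambda>j'. restrict j' T" L] \<open>finite U\<close> by simp
    qed
    also have "(\<Sum>j'\<in>ext S jS. L j') - L j + h_fun (c i) (m j) \<alpha> \<le> (\<Sum>j'\<in>ext S jS. L j') + B j"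
      using h_le[OF jW] by (simp add: B_def)
    also have "\<dots> = h_under V c i D \<alpha>ess S jS"
      unfolding B[symmetric] by (simp add: h_under_def Let_def full_ext_def ext_def[symmetric] W_def[symmetric]
          B_def L_def m_def \<beta>_def)
    finally show ?thesis by (simp add: U_def)
  qed

  have "LBDeu c i D \<alpha>ess T
      = (\<Sum>jS\<in>uniq_on D S. \<Sum>jT\<in>{jT \<in> uniq_on D T. restrict jT S = jS}. LLBDeu c i D \<alpha>ess T jT)"
    unfolding LBDeu_def using restrict_uniq_on[OF ST, of D]
    by (intro sum.group[symmetric]) auto
  also have "\<dots> \<le> ub_h V c i D \<alpha>ess S"
    unfolding ub_h_def by (intro sum_mono main)
  finally show ?thesis .
qed

end
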